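(* Let $S$ be a subring of the ring $R$ such that $R$ is Noetherian as a left $S$-module. If $x\in S$ is invertible in $R$, then $x^{-1}\in S$.
   Context: All rings are associative with identity (not necessarily commutative), and every subring contains the identity of the larger ring. $R$ is regarded as a left $S$-module by left multiplication. *)

theory Defs
  imports "HOL-Algebra.Module" "HOL-Algebra.Subrings"
begin

text \<open>
  The locale \<^locale>\<open>module\<close> of HOL-Algebra requires a commutative base ring. The following is the
  same axiomatization of unital left modules over an arbitrary ring. The locale \<^locale>\<open>submodule\<close>
  does not refer to commutativity and is used unchanged.
\<close>

locale left_module = R?: ring R + M?: abelian_group M
  for R :: "('a, 'm) ring_scheme" (structure) and M :: "('a, 'b, 'n) module_scheme" (structure) +
  assumes smult_closed [simp, intro]:
      "\<lbrakk>a \<in> carrier R; x \<in> carrier M\<rbrakk> \<Longrightarrow> a \<odot>\<^bsub>M\<^esub> x \<in> carrier M"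
    and smult_l_distr:
      "\<lbrakk>a \<in> carrier R; b \<in> carrier R; x \<in> carrier M\<rbrakk> \<Longrightarrow>
      (a \<oplus> b) \<odot>\<^bsub>M\<^esub> x = a \<odot>\<^bsub>M\<^esub> x \<oplus>\<^bsub>M\<^esub> b \<odot>\<^bsub>M\<^esub> x"
    and smult_r_distr:
      "\<lbrakk>a \<in> carrier R; x \<in> carrier M; y \<in> carrier M\<rbrakk> \<Longrightarrow>
      a \<odot>\<^bsub>M\<^esub> (x \<oplus>\<^bsub>M\<^esub> y) = a \<odot>\<^bsub>M\<^esub> x \<oplus>\<^bsub>M\<^esub> a \<odot>\<^bsub>M\<^esub> y"
    and smult_assoc1:
      "\<lbrakk>a \<in> carrier R; b \<in> carrier R; x \<in> carrier M\<rbrakk> \<Longrightarrow>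
      (a \<otimes> b) \<odot>\<^bsub>M\<^esub> x = a \<odot>\<^bsub>M\<^esub> (b \<odot>\<^bsub>M\<^esub> x)"
    and smult_one [simp]:
      "x \<in> carrier M \<Longrightarrow> \<one> \<odot>\<^bsub>M\<^esub> x = x"

text \<open>Ascending chain condition on submodules.\<close>

locale noetherian_left_module = left_module +
  assumes ascending_chain_condition:
    "\<lbrakk>\<And>n :: nat. submodule (N n) R M; \<And>n. N n \<subseteq> N (Suc n)\<rbrakk> \<Longrightarrow> \<exists>m. \<forall>n\<ge>m. N n = N m"

text \<open>
  The additive group of \<open>R\<close> with left multiplication as scalar multiplication. The fields
  \<^const>\<open>mult\<close> and \<^const>\<open>one\<close> are present only because HOL-Algebra module records extend ring
  records. The ring of scalars is not part of the record.
\<close>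

definition left_mult_module :: "('a, 'm) ring_scheme \<Rightarrow> ('a, 'a) module" where
  "left_mult_module R =
    \<lparr>carrier = carrier R, mult = mult R, one = one R, zero = zero R, add = add R,
     smult = mult R\<rparr>"

lemma (in ring) left_module_over_subring:
  assumes "subring S R"
  shows "left_module (R\<lparr>carrier := S\<rparr>) (left_mult_module R)"
proof -
  have sub: "\<And>a. a \<in> S \<Longrightarrow> a \<in> carrier R"
    using subringE(1)[OF assms] by blast
  have M: "abelian_group (left_mult_module R)"
    by (rule abelian_groupI) (auto simp: left_mult_module_def a_ac intro: a_inv_closed l_neg)
  show ?thesis
    by (rule left_module.intro[OF subring_is_ring[OF assms] M], unfold_locales)
      (auto simp: left_mult_module_def sub l_distr r_distr m_assoc)
qed

end

theory Submission
  imports Defs "HOL-Algebra.Multiplicative_Group"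
begin

text \<open>
  Write \<open>y\<close> for the inverse of \<open>x\<close> in \<open>R\<close>. The cyclic left \<open>S\<close>-submodules \<open>S\<close>, \<open>S y\<close>, \<open>S y\<^sup>2\<close>, \<open>\<dots>\<close> of
  \<open>R\<close> form an ascending chain, because \<open>s y\<^sup>n = (s x) y\<^sup>n\<^sup>+\<^sup>1\<close> and \<open>x \<in> S\<close>. The chain condition makes
  it stop, say at \<open>m\<close>, so that \<open>y\<^sup>m\<^sup>+\<^sup>1 = s y\<^sup>m\<close> for some \<open>s \<in> S\<close>. Powers of the unit \<open>y\<close> can be
  cancelled on the right, hence \<open>y = s \<in> S\<close>.
\<close>

lemma (in ring) cyclic_left_submodule:
  assumes S: "subring S R" and a: "a \<in> carrier R"
  shows "submodule ((\<lambda>s. s \<otimes> a) ` S) (R\<lparr>carrier := S\<rparr>) (left_mult_module R)"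
proof -
  have sub: "\<And>s. s \<in> S \<Longrightarrow> s \<in> carrier R"
    using subringE(1)[OF S] by blast
  interpret M: left_module "R\<lparr>carrier := S\<rparr>" "left_mult_module R"
    by (rule left_module_over_subring[OF S])
  \<comment> \<open>Negation is taken in the module record, so it has to be identified with the negation of \<open>R\<close>.\<close>
  have minus: "\<ominus>\<^bsub>left_mult_module R\<^esub> (s \<otimes> a) = (\<ominus> s) \<otimes> a" if "s \<in> S" for s
    by (rule M.M.minus_equality)
      (use that sub a in \<open>auto simp: left_mult_module_def l_distr[symmetric] l_neg\<close>)
  have "subgroup ((\<lambda>s. s \<otimes> a) ` S) (add_monoid (left_mult_module R))"
  proof (rule M.M.add.subgroupI)
    show "(\<lambda>s. s \<otimes> a) ` S \<subseteq> carrier (left_mult_module R)"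
      using sub a by (auto simp: left_mult_module_def)
    show "(\<lambda>s. s \<otimes> a) ` S \<noteq> {}"
      using subringE(2)[OF S] by blast
  next
    fix u assume "u \<in> (\<lambda>s. s \<otimes> a) ` S"
    then show "\<ominus>\<^bsub>left_mult_module R\<^esub> u \<in> (\<lambda>s. s \<otimes> a) ` S"
      using minus subringE(5)[OF S] by auto
  next
    fix u v assume "u \<in> (\<lambda>s. s \<otimes> a) ` S" and "v \<in> (\<lambda>s. s \<otimes> a) ` S"
    then obtain s t where "s \<in> S" "t \<in> S" "u = s \<otimes> a" "v = t \<otimes> a"
      by blast
    moreover from this have "u \<oplus>\<^bsub>left_mult_module R\<^esub> v = (s \<oplus> t) \<otimes> a"
      using sub a by (simp add: left_mult_module_def l_distr)
    ultimately show "u \<oplus>\<^bsub>left_mult_module R\<^esub> v \<in> (\<lambda>s. s \<otimes> a) ` S"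
      using subringE(7)[OF S] by blast
  qed
  moreover have "c \<odot>\<^bsub>left_mult_module R\<^esub> u \<in> (\<lambda>s. s \<otimes> a) ` S"
    if "c \<in> S" "u \<in> (\<lambda>s. s \<otimes> a) ` S" for c u
  proof -
    from that obtain s where s: "s \<in> S" "u = s \<otimes> a"
      by blast
    then have "c \<odot>\<^bsub>left_mult_module R\<^esub> u = (c \<otimes> s) \<otimes> a"
      using that(1) sub a by (simp add: left_mult_module_def m_assoc)
    then show ?thesis
      using subringE(6)[OF S that(1) s(1)] by blast
  qed
  ultimately show ?thesis
    by (simp add: submodule_def submodule_axioms_def)
qed

theorem proposition2p3:
  fixes R :: "('a, 'm) ring_scheme" and S :: "'a set" and x :: 'a
  assumes "ring R"
    and "subring S R"
    and "noetherian_left_module (R\<lparr>carrier := S\<rparr>) (left_mult_module R)"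
    and "x \<in> S"
    and "x \<in> Units R"
  shows "inv\<^bsub>R\<^esub> x \<in> S"
proof -
  interpret ring R by fact
  note S = assms(2)
  define y where "y = inv\<^bsub>R\<^esub> x"
  define N where "N n = (\<lambda>s. s \<otimes>\<^bsub>R\<^esub> y [^]\<^bsub>R\<^esub> n) ` S" for n :: nat
  have sub: "\<And>s. s \<in> S \<Longrightarrow> s \<in> carrier R"
    using subringE(1)[OF S] by blast
  have y: "y \<in> Units R" "y \<in> carrier R" and xy: "x \<otimes>\<^bsub>R\<^esub> y = \<one>\<^bsub>R\<^esub>"
    using \<open>x \<in> Units R\<close> by (auto simp: y_def)
  have y_pow_Suc: "y [^]\<^bsub>R\<^esub> Suc n = y \<otimes>\<^bsub>R\<^esub> y [^]\<^bsub>R\<^esub> n" for n :: nat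
    using nat_pow_Suc2[OF y(2)] .
  have ascending: "N n \<subseteq> N (Suc n)" for n
  proof
    fix u assume "u \<in> N n"
    then obtain s where s: "s \<in> S" "u = s \<otimes>\<^bsub>R\<^esub> y [^]\<^bsub>R\<^esub> n"
      by (auto simp: N_def)
    have "(s \<otimes>\<^bsub>R\<^esub> x) \<otimes>\<^bsub>R\<^esub> y [^]\<^bsub>R\<^esub> Suc n = s \<otimes>\<^bsub>R\<^esub> ((x \<otimes>\<^bsub>R\<^esub> y) \<otimes>\<^bsub>R\<^esub> y [^]\<^bsub>R\<^esub> n)"
      unfolding y_pow_Suc using s sub \<open>x \<in> S\<close> y by (simp add: m_assoc)
    also have "\<dots> = u"
      using s y by (simp add: xy)
    finally show "u \<in> N (Suc n)"
      unfolding N_def using subringE(6)[OF S s(1) \<open>x \<in> S\<close>] by (metis imageI)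
  qed
  obtain m where stable: "\<forall>n\<ge>m. N n = N m"
    using noetherian_left_module.ascending_chain_condition[OF assms(3), of N]
      cyclic_left_submodule[OF S] ascending y(2) by (auto simp: N_def)
  have "y [^]\<^bsub>R\<^esub> Suc m \<in> N (Suc m)"
    unfolding N_def using subringE(3)[OF S] y(2) by (metis imageI l_one nat_pow_closed)
  then have "y [^]\<^bsub>R\<^esub> Suc m \<in> N m"
    using spec[OF stable, of "Suc m"] by auto
  then obtain s where s: "s \<in> S" "y \<otimes>\<^bsub>R\<^esub> y [^]\<^bsub>R\<^esub> m = s \<otimes>\<^bsub>R\<^esub> y [^]\<^bsub>R\<^esub> m"
    unfolding y_pow_Suc by (auto simp: N_def)
  have unit: "y [^]\<^bsub>R\<^esub> m \<in> Units R"
    using y(1) by (rule Units_pow_closed)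
  \<comment> \<open>Cancel \<open>y\<^sup>m\<close> by multiplying with its inverse on the right.\<close>
  have "y = s"
    using s sub y(2) unit
    by (metis Units_closed Units_inv_closed Units_r_inv m_assoc r_one)
  with s(1) show ?thesis
    by (simp add: y_def)
qed

end
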